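(* For all integers $n, m, k$ with $n \geq 1$, $1 \leq k \leq n$ and $0 \leq m \leq n$, there is a bijection $\Gamma$ from $\mathcal{P}_{n,m,k}$ to $\mathcal{P}_{n,n-m,n-k}$ such that if $P \in \mathcal{P}^{UU}_{n,m,k}$ then $\Gamma(P) \in \mathcal{P}^{DD}_{n,n-m,n-k}$, and if $P \in \mathcal{P}^{UD}_{n,m,k}$ then $\Gamma(P) \in \mathcal{P}^{DU}_{n,n-m,n-k}$.
   Context: Let $\mathcal{L}_n$ be the set of lattice paths in $\mathbb{Z}\times\mathbb{Z}$ from $(0,0)$ to $(n,n)$ using up steps $U=(0,1)$ and down steps $D=(1,0)$. A path is identified with a word of length $2n$ in the letters $U, D$ (with $n$ of each). An up step lies below the line $y=x$ if it goes from $(a,b)$ to $(a,b+1)$ with $b<a$. An $(n,m)$-Dyck path is a path in $\mathcal{L}_n$ with exactly $m$ up steps below the line $y=x$. A peak of a path is an occurrence of two consecutive steps $UD$. $\mathcal{P}_{n,m,k}$ denotes the set of all $(n,m)$-Dyck paths with exactly $k$ peaks. For $A,B\in\{U,D\}$, $\mathcal{P}^{AB}_{n,m,k}$ denotes the set of paths in $\mathcal{P}_{n,m,k}$ whose first step is $A$ and whose last step is $B$. *)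

theory Defs
  imports Main
begin

(* U is the step (0,1), D is the step (1,0); a path starting at the origin is the word of
   its steps. *)
datatype step = U | D

definition vertex :: "step list \<Rightarrow> nat \<Rightarrow> nat \<times> nat" where
  "vertex w i = (count_list (take i w) D, count_list (take i w) U)"

definition lattice_paths :: "nat \<Rightarrow> step list set" where
  "lattice_paths n = {w. vertex w (length w) = (n, n)}"

definition up_steps_below :: "step list \<Rightarrow> nat set" where
  "up_steps_below w = {i. i < length w \<and> w ! i = U \<and> (case vertex w i of (a, b) \<Rightarrow> b < a)}"

definition dyck_paths :: "nat \<Rightarrow> nat \<Rightarrow> step list set" where
  "dyck_paths n m = {w \<in> lattice_paths n. card (up_steps_below w) = m}"

definition peaks :: "step list \<Rightarrow> nat set" where
  "peaks w = {i. Suc i < length w \<and> w ! i = U \<and> w ! Suc i = D}"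

definition peak_paths :: "nat \<Rightarrow> nat \<Rightarrow> nat \<Rightarrow> step list set" where
  "peak_paths n m k = {w \<in> dyck_paths n m. card (peaks w) = k}"

definition peak_paths_ends :: "step \<Rightarrow> step \<Rightarrow> nat \<Rightarrow> nat \<Rightarrow> nat \<Rightarrow> step list set" where
  "peak_paths_ends A B n m k = {w \<in> peak_paths n m k. w \<noteq> [] \<and> hd w = A \<and> last w = B}"

end

theory Submission
  imports Defs "HOL-Library.Tree"
begin

text \<open>
  Cut a balanced path at the places where it crosses the diagonal. It falls into nonempty blocks
  that lie alternately above and below the diagonal, and a block of semilength \<open>i\<close> is a Dyck word
  (or its reflection), hence a binary tree with \<open>i\<close> nodes: the first-return decomposition
  \<open>U l D r\<close> of a block above, or \<open>D l U r\<close> of a block below, is a node with subtrees \<open>l\<close> and \<open>r\<close>.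
  No peak straddles a crossing, since at a crossing the path takes the same step twice.
  So the peaks of the path are those of its blocks.

  A node \<open>U l D r\<close> contributes a peak of its own exactly when \<open>l\<close> is empty, and a node \<open>D l U r\<close>
  exactly when \<open>r\<close> is nonempty (the \<open>U\<close> is then followed by the initial \<open>D\<close> of \<open>r\<close>). Therefore,
  if a block is reflected to the other side of the diagonal and its tree is mirrored at the same
  time, every node that contributed a peak ceases to do so and conversely: \<open>p\<close> peaks become
  \<open>i - p\<close> peaks (\<open>peaks_block_mirror\<close>). The up steps below the diagonal are the up steps of the
  lower blocks, so reflection exchanges \<open>m\<close> and \<open>n - m\<close> (\<open>up_below_blocks_mirror\<close>). The bijection
  does this to all blocks at once. Since the side of each block changes, the first and last steps
  of the path are exchanged between \<open>U\<close> and \<open>D\<close>, which is the claim about the ends.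

  The remaining content is that block sequences and balanced words are the same thing: unique
  readability (\<open>blocks_inject\<close>) and existence of the decomposition (\<open>blocks_exist\<close>).
\<close>

section \<open>Blocks and their trees\<close>

fun opp :: "step \<Rightarrow> step" where
  "opp U = D"
| "opp D = U"

lemma opp_opp [simp]: "opp (opp s) = s"
  by (cases s) auto

lemma opp_neq [simp]: "opp s \<noteq> s" "s \<noteq> opp s"
  by (cases s; simp)+

lemma neq_opp_iff: "a \<noteq> s \<longleftrightarrow> a = opp s"
  by (cases a; cases s) auto

text \<open>The first argument is the side: \<open>U\<close> gives words above the diagonal, \<open>D\<close> words below it. The
  nodes carry no information, hence the type \<^typ>\<open>unit tree\<close>.\<close>

fun block :: "step \<Rightarrow> unit tree \<Rightarrow> step list" where
  "block s Leaf = []"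
| "block s (Node l _ r) = s # block s l @ opp s # block s r"

text \<open>The sides alternate, so only the side of the first block has to be recorded. The sequence is
  determined by the word only if no block is empty.\<close>

fun blocks :: "step \<Rightarrow> unit tree list \<Rightarrow> step list" where
  "blocks s [] = []"
| "blocks s (t # ts) = block s t @ blocks (opp s) ts"

lemma block_eq_Nil_iff [simp]: "block s t = [] \<longleftrightarrow> t = Leaf"
  by (cases t) auto

lemma hd_block: "t \<noteq> Leaf \<Longrightarrow> hd (block s t) = s"
  by (cases t) auto

lemma last_block: "t \<noteq> Leaf \<Longrightarrow> last (block s t) = opp s"
  by (induction t) auto

lemma count_list_block: "count_list (block s t) a = size t"
  by (induction t) (cases a; cases s; auto)+

lemma blocks_eq_Nil_iff: "Leaf \<notin> set ts \<Longrightarrow> blocks s ts = [] \<longleftrightarrow> ts = []"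
  by (cases ts) auto

lemma hd_blocks: "Leaf \<notin> set ts \<Longrightarrow> ts \<noteq> [] \<Longrightarrow> hd (blocks s ts) = s"
  by (cases ts) (auto simp: hd_block hd_append)

lemma count_list_blocks: "count_list (blocks s ts) a = sum_list (map size ts)"
  by (induction ts arbitrary: s) (auto simp: count_list_block)

lemma Leaf_in_image_mirror_iff [simp]: "Leaf \<in> mirror ` T \<longleftrightarrow> Leaf \<in> T"
  by (auto simp: image_iff eq_commute[of Leaf])

lemma last_blocks_mirror:
  assumes "Leaf \<notin> set ts" "ts \<noteq> []"
  shows "last (blocks (opp s) (map mirror ts)) = opp (last (blocks s ts))"
  using assms
proof (induction ts arbitrary: s)
  case (Cons t ts)
  have "Leaf \<notin> set (map mirror ts)"
    using Cons.prems by simp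
  then show ?case
    using Cons.prems Cons.IH[of "opp s"]
    by (cases "ts = []") (auto simp: last_append last_block blocks_eq_Nil_iff)
qed simp

section \<open>Words decompose uniquely into blocks\<close>

text \<open>What follows a block never begins with the step that opens the block: after a left subtree
  comes the closing step of its parent, after a right subtree whatever follows the parent, and
  after the whole block a block on the other side. So the next letter always tells whether the
  current subtree has another node.\<close>

lemma block_append_inject:
  assumes "block s t @ x = block s t' @ x'"
    and "x = [] \<or> hd x \<noteq> s" and "x' = [] \<or> hd x' \<noteq> s"
  shows "t = t' \<and> x = x'"
  using assms
proof (induction t arbitrary: t' x x')
  case Leaf
  then show ?case by (cases t') auto
next
  case (Node l a r)
  from Node.prems obtain l' r' where t': "t' = Node l' () r'"
    by (cases t') auto
  from Node.prems t' have "block s l @ (opp s # block s r @ x) = block s l' @ (opp s # block s r' @ x')"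
    by simp
  from Node.IH(1)[OF this] have "l = l'" "block s r @ x = block s r' @ x'"
    by auto
  with Node.IH(2)[OF this(2)] Node.prems t' show ?case
    by simp
qed

lemma blocks_inject_same_side:
  assumes "blocks s ts = blocks s ts'" "Leaf \<notin> set ts" "Leaf \<notin> set ts'"
  shows "ts = ts'"
  using assms
proof (induction ts arbitrary: s ts')
  case Nil
  then show ?case by (metis blocks.simps(1) blocks_eq_Nil_iff)
next
  case (Cons t ts)
  then obtain u us where ts': "ts' = u # us"
    by (cases ts') auto
  have rest: "blocks (opp s) vs = [] \<or> hd (blocks (opp s) vs) \<noteq> s" if "Leaf \<notin> set vs" for vs
    using hd_blocks[OF that, of "opp s"] by (cases vs) auto
  have "t = u \<and> blocks (opp s) ts = blocks (opp s) us"
    using Cons.prems ts' by (intro block_append_inject[OF _ rest rest]) auto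
  then show ?case
    using Cons.IH[of "opp s" us] Cons.prems ts' by simp
qed

lemma blocks_inject:
  assumes "blocks s ts = blocks s' ts'" "Leaf \<notin> set ts" "Leaf \<notin> set ts'" "ts \<noteq> []"
  shows "s = s' \<and> ts = ts'"
proof -
  have "ts' \<noteq> []"
    using assms by (metis blocks.simps(1) blocks_eq_Nil_iff)
  then have "s = s'"
    using assms hd_blocks by metis
  then show ?thesis
    using assms blocks_inject_same_side by blast
qed

text \<open>The counting hypothesis guarantees that every opening step \<open>s\<close> finds its closing partner: the
  scan cannot run out of letters inside an open node.\<close>

lemma block_prefix_exists:
  assumes "count_list w s \<le> count_list w (opp s)"
  shows "\<exists>t x. w = block s t @ x \<and> (x = [] \<or> hd x = opp s)"
  using assms
proof (induction w rule: length_induct)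
  case (1 w)
  show ?case
  proof (cases "w = [] \<or> hd w = opp s")
    case True
    then show ?thesis
      by (intro exI[of _ Leaf] exI[of _ w]) simp
  next
    case False
    then obtain w' where w: "w = s # w'"
      by (metis list.collapse neq_opp_iff)
    then have w'_count: "count_list w' s < count_list w' (opp s)"
      using 1(2) by simp
    with 1(1) w obtain l x where l: "w' = block s l @ x" "x = [] \<or> hd x = opp s"
      by (metis length_Cons lessI less_imp_le)
    with w'_count obtain y where x: "x = opp s # y"
      by (cases x) (auto simp: count_list_block)
    then have "length y < length w" "count_list y s \<le> count_list y (opp s)"
      using w l w'_count by (auto simp: count_list_block)
    with 1(1) obtain r z where "y = block s r @ z" "z = [] \<or> hd z = opp s"
      by blast
    then show ?thesis
      using w l x by (intro exI[of _ "Node l () r"] exI[of _ z]) simp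
  qed
qed

lemma blocks_exist_on_side:
  assumes "count_list w U = count_list w D" "w = [] \<or> hd w = s"
  shows "\<exists>ts. Leaf \<notin> set ts \<and> w = blocks s ts"
  using assms
proof (induction w arbitrary: s rule: length_induct)
  case (1 w)
  show ?case
  proof (cases "w = []")
    case True
    then show ?thesis
      by (intro exI[of _ "[]"]) simp
  next
    case False
    have "count_list w s \<le> count_list w (opp s)"
      using 1(2) by (cases s) auto
    then obtain t x where w: "w = block s t @ x" and x: "x = [] \<or> hd x = opp s"
      using block_prefix_exists by blast
    have t: "t \<noteq> Leaf"
      using w x False 1(3) by auto
    have "length x < length w" "count_list x U = count_list x D"
      using w t 1(2) by (auto simp: count_list_block)
    then obtain ts where "Leaf \<notin> set ts" "x = blocks (opp s) ts"
      using 1(1) x by blast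
    then show ?thesis
      using w t by (intro exI[of _ "t # ts"]) auto
  qed
qed

lemma blocks_exist:
  assumes "count_list w U = count_list w D" "w \<noteq> []"
  obtains s ts where "ts \<noteq> []" "Leaf \<notin> set ts" "w = blocks s ts"
proof -
  obtain ts where "Leaf \<notin> set ts" "w = blocks (hd w) ts"
    using blocks_exist_on_side[OF assms(1)] by blast
  moreover from this have "ts \<noteq> []"
    using assms(2) by (metis blocks.simps(1))
  ultimately show thesis
    using that by blast
qed

section \<open>Peaks\<close>

lemma finite_peaks [simp]: "finite (peaks w)"
  by (rule finite_subset[of _ "{..<length w}"]) (auto simp: peaks_def)

lemma card_peaks_Nil [simp]: "card (peaks []) = 0"
  by (simp add: peaks_def)

lemma card_peaks_Cons [simp]:
  "card (peaks (a # w)) = (if a = U \<and> w \<noteq> [] \<and> hd w = D then 1 else 0) + card (peaks w)"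
proof -
  let ?first = "if a = U \<and> w \<noteq> [] \<and> hd w = D then {0 :: nat} else {}"
  have "i \<in> peaks (a # w) \<longleftrightarrow> i \<in> ?first \<union> Suc ` peaks w" for i
    by (cases i; cases w) (auto simp: peaks_def)
  then have "peaks (a # w) = ?first \<union> Suc ` peaks w"
    by blast
  moreover have "card (?first \<union> Suc ` peaks w) = card ?first + card (Suc ` peaks w)"
    by (intro card_Un_disjoint) auto
  ultimately show ?thesis
    by (simp add: card_image)
qed

lemma card_peaks_append:
  "card (peaks (u @ v)) = card (peaks u) + card (peaks v)
     + (if u \<noteq> [] \<and> v \<noteq> [] \<and> last u = U \<and> hd v = D then 1 else 0)"
  by (induction u) (auto simp: hd_append)

text \<open>At every node, exactly one of the block and its reflected mirror image has a peak that
  belongs to the node: above the diagonal if the left subtree is empty, below the diagonal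
  if the right subtree, which is the mirror image of the left one, is nonempty.\<close>

lemma peaks_block_mirror:
  "card (peaks (block s t)) + card (peaks (block (opp s) (mirror t))) = size t"
proof (induction t)
  case (Node l a r)
  then show ?case
    by (cases s; cases "l = Leaf"; cases "r = Leaf")
       (auto simp: card_peaks_append hd_append hd_block last_block)
qed simp

lemma card_peaks_blocks_Cons:
  assumes "t \<noteq> Leaf" "Leaf \<notin> set ts"
  shows "card (peaks (blocks s (t # ts))) = card (peaks (block s t)) + card (peaks (blocks (opp s) ts))"
  using assms hd_blocks[of ts "opp s"]
  by (cases "ts = []") (auto simp: card_peaks_append last_block)

lemma peaks_blocks_mirror:
  assumes "Leaf \<notin> set ts"
  shows "card (peaks (blocks s ts)) + card (peaks (blocks (opp s) (map mirror ts)))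
           = sum_list (map size ts)"
  using assms
proof (induction ts arbitrary: s)
  case (Cons t ts)
  have "Leaf \<notin> set (map mirror ts)"
    using Cons.prems by simp
  then have "card (peaks (blocks (opp s) (map mirror (t # ts))))
      = card (peaks (block (opp s) (mirror t))) + card (peaks (blocks s (map mirror ts)))"
    using card_peaks_blocks_Cons[of "mirror t" "map mirror ts" "opp s"] Cons.prems by auto
  then show ?case
    using Cons.prems Cons.IH[of "opp s"] peaks_block_mirror[of s t]
    by (auto simp: card_peaks_blocks_Cons simp del: blocks.simps)
qed simp

section \<open>Up steps below the diagonal\<close>

text \<open>The first argument is the height \<open>y - x\<close> at which the word starts. It is needed because the
  pieces inside a block start away from the diagonal.\<close>

fun up_below :: "int \<Rightarrow> step list \<Rightarrow> nat" where
  "up_below h [] = 0"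
| "up_below h (U # w) = (if h < 0 then 1 else 0) + up_below (h + 1) w"
| "up_below h (D # w) = up_below (h - 1) w"

lemma up_below_append:
  "up_below h (u @ v) = up_below h u + up_below (h + int (count_list u U) - int (count_list u D)) v"
  by (induction h u rule: up_below.induct) (auto simp: algebra_simps)

lemma finite_up_steps_below [simp]: "finite (up_steps_below w)"
  by (rule finite_subset[of _ "{..<length w}"]) (auto simp: up_steps_below_def)

lemma card_up_steps_below: "card (up_steps_below w) = up_below 0 w"
proof (induction w rule: rev_induct)
  case Nil
  then show ?case by (simp add: up_steps_below_def)
next
  case (snoc a w)
  let ?new = "if a = U \<and> count_list w U < count_list w D then {length w} else {}"
  have "i \<in> up_steps_below (w @ [a]) \<longleftrightarrow> i \<in> up_steps_below w \<union> ?new" for i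
    by (auto simp: up_steps_below_def vertex_def nth_append less_Suc_eq)
  then have "up_steps_below (w @ [a]) = up_steps_below w \<union> ?new"
    by blast
  moreover have "card (up_steps_below w \<union> ?new) = card (up_steps_below w) + card ?new"
    by (intro card_Un_disjoint) (auto simp: up_steps_below_def)
  ultimately show ?case
    using snoc by (cases a) (auto simp: up_below_append)
qed

lemma up_below_block_U: "h \<ge> 0 \<Longrightarrow> up_below h (block U t) = 0"
  by (induction t arbitrary: h) (auto simp: up_below_append count_list_block)

lemma up_below_block_D: "h \<le> 0 \<Longrightarrow> up_below h (block D t) = size t"
  by (induction t arbitrary: h) (auto simp: up_below_append count_list_block)

lemma up_below_blocks_mirror:
  "up_below 0 (blocks s ts) + up_below 0 (blocks (opp s) (map mirror ts)) = sum_list (map size ts)"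
proof (induction ts arbitrary: s)
  case (Cons t ts)
  then show ?case
    using Cons.IH[of "opp s"]
    by (cases s) (auto simp: up_below_append count_list_block up_below_block_U up_below_block_D)
qed simp

section \<open>The bijection\<close>

lemma peak_paths_iff:
  "w \<in> peak_paths n m k \<longleftrightarrow>
     count_list w D = n \<and> count_list w U = n \<and> up_below 0 w = m \<and> card (peaks w) = k"
  by (auto simp: peak_paths_def dyck_paths_def lattice_paths_def vertex_def card_up_steps_below)

text \<open>The empty sequence is excluded because the empty word would have two codes, one for each
  side.\<close>

definition block_codes :: "nat \<Rightarrow> nat \<Rightarrow> nat \<Rightarrow> (step \<times> unit tree list) set" where
  "block_codes n m k =
     {(s, ts). ts \<noteq> [] \<and> Leaf \<notin> set ts \<and> blocks s ts \<in> peak_paths n m k}"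

lemma bij_betw_blocks:
  assumes "n \<ge> 1"
  shows "bij_betw (\<lambda>(s, ts). blocks s ts) (block_codes n m k) (peak_paths n m k)"
proof (intro bij_betwI')
  fix w assume w: "w \<in> peak_paths n m k"
  then have "count_list w U = count_list w D" "w \<noteq> []"
    using assms by (auto simp: peak_paths_iff)
  then obtain s ts where "ts \<noteq> []" "Leaf \<notin> set ts" "w = blocks s ts"
    by (rule blocks_exist)
  then show "\<exists>c \<in> block_codes n m k. w = (case c of (s, ts) \<Rightarrow> blocks s ts)"
    using w by (intro bexI[of _ "(s, ts)"]) (auto simp: block_codes_def)
qed (auto simp: block_codes_def dest: blocks_inject)

definition flip_blocks :: "step \<times> unit tree list \<Rightarrow> step \<times> unit tree list" where
  "flip_blocks = (\<lambda>(s, ts). (opp s, map mirror ts))"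

lemma flip_blocks_flip_blocks [simp]: "flip_blocks (flip_blocks c) = c"
  by (cases c) (simp add: flip_blocks_def comp_def)

lemma flip_blocks_in_block_codes:
  assumes "c \<in> block_codes n m k"
  shows "flip_blocks c \<in> block_codes n (n - m) (n - k)"
proof -
  obtain s ts where c: "c = (s, ts)" "ts \<noteq> []" "Leaf \<notin> set ts" "blocks s ts \<in> peak_paths n m k"
    using assms by (auto simp: block_codes_def)
  have "n = sum_list (map size ts)"
    using c(4) by (simp add: peak_paths_iff count_list_blocks)
  moreover have "Leaf \<notin> set (map mirror ts)"
    using c(3) by simp
  moreover have "count_list (blocks (opp s) (map mirror ts)) a = sum_list (map size ts)" for a
    by (simp add: count_list_blocks comp_def)
  ultimately show ?thesis
    using c peaks_blocks_mirror[OF c(3), of s] up_below_blocks_mirror[of s ts]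
    by (auto simp: block_codes_def flip_blocks_def peak_paths_iff)
qed

text \<open>The bounds make \<open>n - (n - m) = m\<close> and \<open>n - (n - k) = k\<close> hold for truncated subtraction, so
  that flipping leads back to where it started.\<close>

lemma bij_betw_flip_blocks:
  assumes "m \<le> n" "k \<le> n"
  shows "bij_betw flip_blocks (block_codes n m k) (block_codes n (n - m) (n - k))"
  using assms flip_blocks_in_block_codes[of _ n "n - m" "n - k"]
  by (intro bij_betw_byWitness[where f' = flip_blocks]) (auto intro: flip_blocks_in_block_codes)

theorem theorem1:
  fixes n m k :: nat
  assumes "n \<ge> 1" and "1 \<le> k" and "k \<le> n" and "m \<le> n"
  shows "\<exists>\<Gamma>. bij_betw \<Gamma> (peak_paths n m k) (peak_paths n (n - m) (n - k)) \<and>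
    (\<forall>P \<in> peak_paths_ends U U n m k. \<Gamma> P \<in> peak_paths_ends D D n (n - m) (n - k)) \<and>
    (\<forall>P \<in> peak_paths_ends U D n m k. \<Gamma> P \<in> peak_paths_ends D U n (n - m) (n - k))"
proof -
  let ?word = "\<lambda>(s, ts). blocks s ts"
  define code where "code = inv_into (block_codes n m k) ?word"
  define \<Gamma> where "\<Gamma> = ?word \<circ> flip_blocks \<circ> code"
  note word_bij = bij_betw_blocks[OF \<open>n \<ge> 1\<close>, of m k]
  have code_bij: "bij_betw code (peak_paths n m k) (block_codes n m k)"
    unfolding code_def by (rule bij_betw_inv_into[OF word_bij])
  have \<Gamma>_bij: "bij_betw \<Gamma> (peak_paths n m k) (peak_paths n (n - m) (n - k))"
    unfolding \<Gamma>_def comp_assoc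
    using bij_betw_trans[OF code_bij bij_betw_flip_blocks[OF \<open>m \<le> n\<close> \<open>k \<le> n\<close>]]
    by (rule bij_betw_trans) (rule bij_betw_blocks[OF \<open>n \<ge> 1\<close>])
  have ends: "\<Gamma> P \<in> peak_paths_ends (opp A) (opp B) n (n - m) (n - k)"
    if P: "P \<in> peak_paths_ends A B n m k" for A B P
  proof -
    have mem: "P \<in> peak_paths n m k" and hd: "hd P = A" and last: "last P = B"
      using P by (auto simp: peak_paths_ends_def)
    obtain s ts where c: "code P = (s, ts)"
      by fastforce
    have "(s, ts) \<in> block_codes n m k"
      using bij_betwE[OF code_bij] mem c by metis
    then have ts: "ts \<noteq> []" "Leaf \<notin> set ts"
      by (auto simp: block_codes_def)
    have "?word (code P) = P"
      unfolding code_def by (rule bij_betw_inv_into_right[OF word_bij mem])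
    then have "P = blocks s ts"
      using c by simp
    moreover have "\<Gamma> P = blocks (opp s) (map mirror ts)"
      using c by (simp add: \<Gamma>_def flip_blocks_def)
    moreover have "Leaf \<notin> set (map mirror ts)"
      using ts by simp
    moreover have "\<Gamma> P \<in> peak_paths n (n - m) (n - k)"
      using bij_betwE[OF \<Gamma>_bij] mem by blast
    ultimately show ?thesis
      using ts hd last hd_blocks[of ts s] hd_blocks[of "map mirror ts" "opp s"]
        last_blocks_mirror[of ts s] blocks_eq_Nil_iff[of "map mirror ts" "opp s"]
      by (simp add: peak_paths_ends_def)
  qed
  show ?thesis
    using \<Gamma>_bij ends[of _ U U] ends[of _ U D] by (intro exI[of _ \<Gamma>]) auto
qed

end
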